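(* Consider an upstream tree with $L$ links of capacities $C_1,\dots,C_L>0$ and $K$ classes with pairwise distinct routes, with arrival rates $\lambda_k>0$ and inverse mean flow sizes $\mu_k>0$, whose traffic intensities $\rho_k=\lambda_k/\mu_k$ satisfy the optimal stability conditions $$\sum_{k:\,l\in r_k}\rho_k<C_l\qquad\text{for all } 1\le l\le L.$$ Then there exist positive access rates $a_1,\dots,a_K$, small enough, such that the resulting stochastic process $(N(t))$ is ergodic.
   Context: Network: there are $L$ links, link $l$ having capacity $C_l>0$, and $K$ classes of flows. Class $k$ has access rate $a_k>0$ and a route $r_k=(r_k(1),\dots,r_k(d_k))$ which is an ordered sequence of $d_k$ distinct links. The network is an upstream tree if (i) there is a common root link, say link $1$, with $r_k(d_k)=1$ for all classes $k$; and (ii) for any two classes $j,k$ there is $m$ such that they have only their last $m$ links in common: $r_j(d_j-i)=r_k(d_k-i)$ for $0\le i\le m-1$, and $r_j(i_j)\ne r_k(i_k)$ for all $1\le i_j\le d_j-m$, $1\le i_k\le d_k-m$. Tail-dropping allocation: for $x\in\mathbb{R}_+^K$ (input rates), put $\theta_k^0(x)=x_k$ and, for $1\le i\le d_k$ with $l=r_k(i)$, $$\theta_k^i(x)=\theta_k^{i-1}(x)\min\Big(\frac{C_l}{R_l(x)},1\Big),\qquad R_l(x)=\sum_{(k',i'):\,r_{k'}(i')=l}\theta_{k'}^{i'-1}(x)$$ (the minimum is $1$ if $R_l(x)=0$). In an acyclic network, in particular an upstream tree, this defines the $\theta_k^i$ uniquely. The throughput of class $k$ is $\psi_k(x)=\theta_k^{d_k}(x)$,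 and $\phi_k(n)=\psi_k(a_1n_1,\dots,a_Kn_K)$ for $n\in\mathbb{N}^K$. $(N(t))$ is the Markov jump process on $\mathbb{N}^K$ with transitions $n\to n+e_k$ at rate $\lambda_k$ and $n\to n-e_k$ at rate $\mu_k\phi_k(n)$, $1\le k\le K$ ($e_k$ is the unit vector of coordinate $k$). Ergodic means positive recurrent. *)

theory Defs
  imports "HOL-Probability.Probability"
begin

section \<open>Upstream trees\<close>

text \<open>Links are the elements of a finite type \<^typ>\<open>'l\<close>, classes those of a finite type \<^typ>\<open>'k\<close>.
  Routes are lists, so that \<open>r k ! i\<close> is the link $r_k(i+1)$ and \<open>length (r k)\<close> is $d_k$.\<close>

definition upstream_tree :: "('k \<Rightarrow> 'l list) \<Rightarrow> bool" where
  "upstream_tree r \<longleftrightarrow>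
     (\<forall>k. r k \<noteq> [] \<and> distinct (r k)) \<and>
     (\<exists>root. \<forall>k. last (r k) = root) \<and>
     (\<forall>j k. \<exists>m. m \<le> length (r j) \<and> m \<le> length (r k) \<and>
        (\<forall>i<m. r j ! (length (r j) - 1 - i) = r k ! (length (r k) - 1 - i)) \<and>
        (\<forall>i<length (r j) - m. \<forall>i'<length (r k) - m. r j ! i \<noteq> r k ! i'))"


section \<open>Tail dropping\<close>

definition link_load :: "('k::finite \<Rightarrow> 'l list) \<Rightarrow> ('k \<Rightarrow> nat \<Rightarrow> real) \<Rightarrow> 'l \<Rightarrow> real" where
  "link_load r \<theta> l = (\<Sum>(k, i)\<in>{(k, i). i < length (r k) \<and> r k ! i = l}. \<theta> k i)"

definition pass_fraction :: "real \<Rightarrow> real \<Rightarrow> real" where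
  "pass_fraction c R = (if R = 0 then 1 else min (c / R) 1)"

text \<open>\<open>\<theta> k i\<close> is the rate of class \<open>k\<close> after its first \<open>i\<close> links; values with
  \<open>i > length (r k)\<close> are irrelevant.\<close>

definition tail_dropping ::
    "('l \<Rightarrow> real) \<Rightarrow> ('k::finite \<Rightarrow> 'l list) \<Rightarrow> ('k \<Rightarrow> real) \<Rightarrow> ('k \<Rightarrow> nat \<Rightarrow> real) \<Rightarrow> bool" where
  "tail_dropping C r x \<theta> \<longleftrightarrow>
     (\<forall>k. \<theta> k 0 = x k) \<and>
     (\<forall>k. \<forall>i<length (r k).
        \<theta> k (Suc i) = \<theta> k i * pass_fraction (C (r k ! i)) (link_load r \<theta> (r k ! i)))"

definition throughput ::
    "('l \<Rightarrow> real) \<Rightarrow> ('k::finite \<Rightarrow> 'l list) \<Rightarrow> ('k \<Rightarrow> real) \<Rightarrow> 'k \<Rightarrow> real" where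
  "throughput C r x = (THE \<psi>. \<exists>\<theta>. tail_dropping C r x \<theta> \<and> \<psi> = (\<lambda>k. \<theta> k (length (r k))))"

definition flow_throughput ::
    "('l \<Rightarrow> real) \<Rightarrow> ('k::finite \<Rightarrow> 'l list) \<Rightarrow> ('k \<Rightarrow> real) \<Rightarrow> ('k \<Rightarrow> nat) \<Rightarrow> 'k \<Rightarrow> real" where
  "flow_throughput C r a n = throughput C r (\<lambda>k. a k * real (n k))"

text \<open>The definite description is well defined: in an upstream tree a link is at the same distance
  from the root on all routes, so the equations can be solved by descending distance.\<close>

lemma upstream_tree_same_depth:
  assumes U: "upstream_tree r" and i: "i < length (r j)" and i': "i' < length (r k)"
    and eq: "r j ! i = r k ! i'"
  shows "length (r j) - i = length (r k) - i'"
proof -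
  obtain m where m: "m \<le> length (r j)" "m \<le> length (r k)"
      "\<And>i. i < m \<Longrightarrow> r j ! (length (r j) - 1 - i) = r k ! (length (r k) - 1 - i)"
      "\<And>i i'. i < length (r j) - m \<Longrightarrow> i' < length (r k) - m \<Longrightarrow> r j ! i \<noteq> r k ! i'"
    using U unfolding upstream_tree_def by metis
  have dist: "distinct (r j)" "distinct (r k)"
    using U by (auto simp: upstream_tree_def)
  consider "length (r j) - m \<le> i" | "length (r k) - m \<le> i'"
    using m(4)[of i i'] eq by fastforce
  then show ?thesis
  proof cases
    case 1
    have "r j ! i = r k ! (length (r k) - 1 - (length (r j) - 1 - i))"
      using m(3)[of "length (r j) - 1 - i"] 1 i m(1) by fastforce
    then have "i' = length (r k) - 1 - (length (r j) - 1 - i)"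
      using dist(2) eq i' by (simp add: nth_eq_iff_index_eq)
    then show ?thesis using 1 i i' m by linarith
  next
    case 2
    have "r k ! i' = r j ! (length (r j) - 1 - (length (r k) - 1 - i'))"
      using m(3)[of "length (r k) - 1 - i'"] 2 i' m(2) by fastforce
    then have "i = length (r j) - 1 - (length (r k) - 1 - i')"
      using dist(1) eq i by (simp add: nth_eq_iff_index_eq)
    then show ?thesis using 2 i i' m by linarith
  qed
qed

lemma tail_dropping_unique:
  fixes r :: "'k::finite \<Rightarrow> 'l list"
  assumes U: "upstream_tree r" and T: "tail_dropping C r x \<theta>" and T': "tail_dropping C r x \<theta>'"
    and le: "i \<le> length (r k)"
  shows "\<theta> k i = \<theta>' k i"
proof -
  define D where "D = (\<Sum>k\<in>UNIV. length (r k))"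
  have D: "length (r k) \<le> D" for k
    unfolding D_def by (rule member_le_sum) auto
  have "\<theta> k i = \<theta>' k i" if "i \<le> length (r k)" "i + (D - length (r k)) = s" for s k i
    using that
  proof (induction s arbitrary: k i rule: less_induct)
    case (less s)
    show ?case
    proof (cases i)
      case 0
      then show ?thesis using T T' by (simp add: tail_dropping_def)
    next
      case (Suc i0)
      have i0: "i0 < length (r k)" using less.prems Suc by simp
      have 1: "\<theta> k i0 = \<theta>' k i0"
        using less.IH[of "i0 + (D - length (r k))" i0 k] less.prems Suc by simp
      have 2: "link_load r \<theta> (r k ! i0) = link_load r \<theta>' (r k ! i0)"
        unfolding link_load_def
      proof (rule sum.cong[OF refl], clarify)
        fix j i' assume j: "i' < length (r j)" "r j ! i' = r k ! i0"
        have "length (r j) - i' = length (r k) - i0"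
          using upstream_tree_same_depth[OF U j(1) i0 j(2)] .
        then have "i' + (D - length (r j)) < s"
          using D[of j] D[of k] j(1) i0 less.prems Suc by linarith
        then show "\<theta> j i' = \<theta>' j i'"
          using less.IH j(1) by simp
      qed
      show ?thesis
        using T T' i0 1 2 Suc by (simp add: tail_dropping_def)
    qed
  qed
  then show ?thesis using le by blast
qed

lemma tail_dropping_exists:
  fixes r :: "'k::finite \<Rightarrow> 'l list"
  assumes U: "upstream_tree r"
  shows "\<exists>\<theta>. tail_dropping C r x \<theta>"
proof -
  define D where "D = (\<Sum>k\<in>UNIV. length (r k))"
  have D: "length (r k) \<le> D" for k
    unfolding D_def by (rule member_le_sum) auto
  define off where "off k = D - length (r k)" for k
  define step where "step s v k = (if s < off k then x k else v k * pass_fraction (C (r k ! (s - off k)))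
      (\<Sum>j\<in>{j. off j \<le> s \<and> s - off j < length (r j) \<and> r j ! (s - off j) = r k ! (s - off k)}. v j))"
    for s and v :: "'k \<Rightarrow> real" and k
  define V where "V = rec_nat x step"
  have V0: "V 0 = x" and VS: "V (Suc s) = step s (V s)" for s
    by (auto simp: V_def)
  have Voff: "V s k = x k" if "s \<le> off k" for s k
    using that by (cases s) (auto simp: V0 VS step_def)
  define \<theta> where "\<theta> k i = V (i + off k) k" for k i
  have "tail_dropping C r x \<theta>"
    unfolding tail_dropping_def
  proof (intro conjI allI impI)
    fix k show "\<theta> k 0 = x k" by (simp add: \<theta>_def Voff)
  next
    fix k i assume i: "i < length (r k)"
    let ?s = "i + off k"
    let ?A = "{j. off j \<le> ?s \<and> ?s - off j < length (r j) \<and> r j ! (?s - off j) = r k ! i}"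
    have A: "{(j, i'). i' < length (r j) \<and> r j ! i' = r k ! i} = (\<lambda>j. (j, ?s - off j)) ` ?A"
    proof (intro set_eqI iffI)
      fix p assume "p \<in> {(j, i'). i' < length (r j) \<and> r j ! i' = r k ! i}"
      then obtain j i' where p: "p = (j, i')" and j: "i' < length (r j)" "r j ! i' = r k ! i"
        by auto
      have "length (r j) - i' = length (r k) - i"
        using upstream_tree_same_depth[OF U j(1) i j(2)] .
      then have "i' + off j = ?s"
        using D[of j] D[of k] j(1) i unfolding off_def by linarith
      then have "i' = ?s - off j" "off j \<le> ?s" by simp_all
      then show "p \<in> (\<lambda>j. (j, ?s - off j)) ` ?A"
        using p j by auto
    qed auto
    have "link_load r \<theta> (r k ! i) = (\<Sum>j\<in>?A. V ?s j)"
      unfolding link_load_def A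
      by (subst sum.reindex) (auto simp: inj_on_def \<theta>_def intro!: sum.cong)
    then show "\<theta> k (Suc i) = \<theta> k i * pass_fraction (C (r k ! i)) (link_load r \<theta> (r k ! i))"
      by (simp add: \<theta>_def VS step_def)
  qed
  then show ?thesis by blast
qed

lemma throughput_eq:
  fixes r :: "'k::finite \<Rightarrow> 'l list"
  assumes "upstream_tree r" "tail_dropping C r x \<theta>"
  shows "throughput C r x = (\<lambda>k. \<theta> k (length (r k)))"
  unfolding throughput_def
  using tail_dropping_unique[OF assms(1) assms(2)] assms(2)
  by (intro the_equality) (blast, metis order_refl)


section \<open>Markov jump processes\<close>

text \<open>\<open>q x y\<close> is the transition rate from \<open>x\<close> to \<open>y \<noteq> x\<close>; the diagonal of \<open>q\<close> is ignored.\<close>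

definition exit_rate :: "('s::countable \<Rightarrow> 's \<Rightarrow> real) \<Rightarrow> 's \<Rightarrow> real" where
  "exit_rate q x = (\<Sum>\<^sub>\<infinity>y\<in>- {x}. q x y)"

text \<open>\<^const>\<open>embed_pmf\<close> is meaningful here when the off-diagonal rates out of \<open>x\<close> are
  nonnegative and summable.\<close>

definition jump_pmf :: "('s::countable \<Rightarrow> 's \<Rightarrow> real) \<Rightarrow> 's \<Rightarrow> 's pmf" where
  "jump_pmf q x =
     (if exit_rate q x = 0 then return_pmf x
      else embed_pmf (\<lambda>y. if y = x then 0 else q x y / exit_rate q x))"

lemma pmf_jump_pmf:
  assumes nonneg: "\<And>y. y \<noteq> x \<Longrightarrow> 0 \<le> q x y" and summable: "q x summable_on - {x}"
    and exit: "exit_rate q x \<noteq> 0"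
  shows "pmf (jump_pmf q x) y = (if y = x then 0 else q x y / exit_rate q x)"
proof -
  let ?f = "\<lambda>y. if y = x then 0 else q x y / exit_rate q x"
  have pos: "0 \<le> exit_rate q x"
    unfolding exit_rate_def using nonneg by (intro infsum_nonneg) auto
  have f: "0 \<le> ?f y" for y
    using nonneg pos by simp
  have "((\<lambda>y. q x y / exit_rate q x) has_sum (exit_rate q x / exit_rate q x)) (- {x})"
    unfolding exit_rate_def divide_inverse
    by (intro has_sum_cmult_left has_sum_infsum summable)
  then have sum: "(?f has_sum 1) UNIV"
    using exit by (subst has_sum_cong_neutral[where T = "- {x}"]) auto
  then have "Infinite_Sum.abs_summable_on ?f UNIV"
    using f has_sum_imp_summable[OF sum]
    by (subst summable_on_cong[where g = ?f]) (auto simp del: if_split)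
  then have abs: "Infinite_Set_Sum.abs_summable_on ?f UNIV"
    by (simp only: abs_summable_equivalent)
  have "(\<integral>\<^sup>+y. ennreal (?f y) \<partial>count_space UNIV) = ennreal (infsetsum ?f UNIV)"
    by (rule nn_integral_conv_infsetsum[OF abs f])
  also have "infsetsum ?f UNIV = 1"
    using infsetsum_infsum[OF abs] infsumI[OF sum] by simp
  finally have "(\<integral>\<^sup>+y. ennreal (?f y) \<partial>count_space UNIV) = 1"
    by simp
  then show ?thesis
    using f exit by (simp add: jump_pmf_def pmf_embed_pmf)
qed

text \<open>The process is built from its jump chain and its holding times. The \<open>n\<close>-th element of the
  stream carries a standard exponential clock and, independently for each state \<open>x\<close>, a
  successor drawn from the jump distribution at \<open>x\<close>; the chain started at \<open>x\<close> follows the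
  successor of its current state, and the clock is divided by the exit rate of that state.\<close>

definition jump_noise :: "('s::countable \<Rightarrow> 's \<Rightarrow> real) \<Rightarrow> (real \<times> ('s \<Rightarrow> 's)) stream measure" where
  "jump_noise q = stream_space
     (density lborel (exponential_density 1) \<Otimes>\<^sub>M (\<Pi>\<^sub>M x\<in>UNIV. measure_pmf (jump_pmf q x)))"

primrec jump_chain :: "'s \<Rightarrow> (real \<times> ('s \<Rightarrow> 's)) stream \<Rightarrow> nat \<Rightarrow> 's" where
  "jump_chain x \<omega> 0 = x"
| "jump_chain x \<omega> (Suc n) = snd (\<omega> !! n) (jump_chain x \<omega> n)"

text \<open>Holding times are infinite in absorbing states.\<close>

definition holding_time ::
    "('s::countable \<Rightarrow> 's \<Rightarrow> real) \<Rightarrow> 's \<Rightarrow> (real \<times> ('s \<Rightarrow> 's)) stream \<Rightarrow> nat \<Rightarrow> ennreal" where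
  "holding_time q x \<omega> n = ennreal (fst (\<omega> !! n)) / ennreal (exit_rate q (jump_chain x \<omega> n))"

definition jump_time ::
    "('s::countable \<Rightarrow> 's \<Rightarrow> real) \<Rightarrow> 's \<Rightarrow> (real \<times> ('s \<Rightarrow> 's)) stream \<Rightarrow> nat \<Rightarrow> ennreal" where
  "jump_time q x \<omega> n = (\<Sum>i<n. holding_time q x \<omega> i)"

text \<open>The minimal process with rates \<open>q\<close> and initial state \<open>x\<close>; it is \<^const>\<open>None\<close> from the
  explosion time on.\<close>

definition jump_process ::
    "('s::countable \<Rightarrow> 's \<Rightarrow> real) \<Rightarrow> 's \<Rightarrow> real \<Rightarrow> (real \<times> ('s \<Rightarrow> 's)) stream \<Rightarrow> 's option" where
  "jump_process q x t \<omega> =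
     (if \<exists>n. jump_time q x \<omega> n \<le> ennreal t \<and> ennreal t < jump_time q x \<omega> (Suc n)
      then Some (jump_chain x \<omega>
             (THE n. jump_time q x \<omega> n \<le> ennreal t \<and> ennreal t < jump_time q x \<omega> (Suc n)))
      else None)"

definition return_time ::
    "('s::countable \<Rightarrow> 's \<Rightarrow> real) \<Rightarrow> 's \<Rightarrow> (real \<times> ('s \<Rightarrow> 's)) stream \<Rightarrow> ennreal" where
  "return_time q x \<omega> =
     (INF t\<in>{t::real. 0 \<le> t \<and> jump_time q x \<omega> 1 \<le> ennreal t \<and> jump_process q x t \<omega> = Some x}.
        ennreal t)"

definition positive_recurrent :: "('s::countable \<Rightarrow> 's \<Rightarrow> real) \<Rightarrow> bool" where
  "positive_recurrent q \<longleftrightarrow>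
     (\<forall>x. exit_rate q x = 0 \<or> (\<integral>\<^sup>+\<omega>. return_time q x \<omega> \<partial>jump_noise q) < \<infinity>)"


section \<open>The flow-level process\<close>

text \<open>The last condition says $m = n - e_k$, and in particular $n_k > 0$.\<close>

definition network_rates ::
    "('l \<Rightarrow> real) \<Rightarrow> ('k::finite \<Rightarrow> 'l list) \<Rightarrow> ('k \<Rightarrow> real) \<Rightarrow> ('k \<Rightarrow> real) \<Rightarrow> ('k \<Rightarrow> real) \<Rightarrow>
     ('k \<Rightarrow> nat) \<Rightarrow> ('k \<Rightarrow> nat) \<Rightarrow> real" where
  "network_rates C r a arr \<mu> n m =
     (\<Sum>k\<in>UNIV. (if m = n(k := Suc (n k)) then arr k else 0) +
               (if n = m(k := Suc (m k)) then \<mu> k * flow_throughput C r a n k else 0))"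

end

theory Submission
  imports Defs
begin

text \<open>
Write \<open>\<rho> k = arr k / \<mu> k\<close>. The proof exhibits a Lyapunov function. Suppose first that input rates
\<open>x k\<close> move continuously with velocity \<open>\<rho> k - \<psi> k\<close>, where \<open>\<psi>\<close> is the throughput for
input \<open>x\<close>. As the stability conditions are strict, there is some \<open>y\<close> with \<open>y k > \<rho> k\<close> that still
satisfies them. In an upstream tree, the classes with \<open>x k > y k\<close> together always have at least the
throughput given by their sum of \<open>y k\<close>, however unfair the sharing between them may be
(\<open>sum_throughput_ge\<close>): the capacity of a saturated link that they do not get is used by classes with \<open>x k \<le> y k\<close>, whose
throughput is at most \<open>y k\<close>. Hence the total excess \<open>\<Sum>k. max 0 (x k - y k)\<close> decreases at a rate
bounded away from zero as long as it is positive.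

For the jump process, weighting class \<open>k\<close> with \<open>1 / \<mu> k\<close> turns its drift into \<open>\<rho> k - \<psi> k\<close>. The excess
over a threshold is not smooth, though: at the threshold itself, arrivals count and departures do
not, which costs \<open>\<rho> k\<close>. This loss does not become small with the access rates, but the excesses
over \<open>M\<close> consecutive integer thresholds can be added up. A class sits at no more than one
of them at a time, so that the total loss stays at most \<open>\<Sum>\<rho>\<close>, whereas the gain is
multiplied by \<open>M\<close>. All \<open>M\<close> thresholds must correspond to input rates that satisfy the capacity
constraints, and this is where small access rates are needed.

It remains to pass from a negative drift outside a finite set to positive recurrence of the
process constructed from clocks and successor maps (\<open>positive_recurrent_if_negative_drift\<close>). The
Lyapunov function is modified so that the drift is negative outside a single state \<open>x\<close>, and then
bounds the mean cost of hitting \<open>x\<close> by decomposition at the first jump.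
\<close>

section \<open>Throughput in upstream trees\<close>

lemma upstream_tree_same_suffix:
  assumes U: "upstream_tree r" and i: "i < length (r j)" and i': "i' < length (r k)"
    and eq: "r j ! i = r k ! i'"
  shows "drop i (r j) = drop i' (r k)"
proof -
  obtain m where m: "m \<le> length (r j)" "m \<le> length (r k)"
      "\<And>i. i < m \<Longrightarrow> r j ! (length (r j) - 1 - i) = r k ! (length (r k) - 1 - i)"
      "\<And>i i'. i < length (r j) - m \<Longrightarrow> i' < length (r k) - m \<Longrightarrow> r j ! i \<noteq> r k ! i'"
    using U unfolding upstream_tree_def by metis
  have len: "length (r j) - i = length (r k) - i'"
    by (rule upstream_tree_same_depth[OF assms])
  have "length (r j) - m \<le> i \<or> length (r k) - m \<le> i'"
    using m(4)[of i i'] eq by fastforce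
  then have le: "length (r j) - i \<le> m"
    using len by linarith
  show ?thesis
  proof (rule nth_equalityI)
    show "length (drop i (r j)) = length (drop i' (r k))" using len by simp
  next
    fix t assume "t < length (drop i (r j))"
    then have t: "t < length (r j) - i" by simp
    have 1: "length (r j) - 1 - (length (r j) - i - 1 - t) = i + t"
      and 2: "length (r k) - 1 - (length (r j) - i - 1 - t) = i' + t"
      using t len i i' by linarith+
    have "length (r j) - i - 1 - t < m" using t le by linarith
    from m(3)[OF this] show "drop i (r j) ! t = drop i' (r k) ! t"
      using 1 2 i i' by simp
  qed
qed

lemma pass_fraction_pos: "0 < c \<Longrightarrow> 0 \<le> R \<Longrightarrow> 0 < pass_fraction c R"
  and pass_fraction_le_1: "pass_fraction c R \<le> 1"
  by (auto simp: pass_fraction_def)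

text \<open>A link on which the loads were negative would turn rates negative, so the sign has to be propagated
through the whole network, link by link in the direction of the root. The quantity
\<open>i + (D - length (r k))\<close> depends only on the distance of the link \<open>r k ! i\<close> to the root.\<close>

lemma tail_dropping_nonneg:
  fixes r :: "'k::finite \<Rightarrow> 'l list"
  assumes U: "upstream_tree r" and T: "tail_dropping C r x \<theta>" and C: "\<And>l. C l > 0"
    and x: "\<And>k. x k \<ge> 0" and le: "i \<le> length (r k)"
  shows "0 \<le> \<theta> k i"
proof -
  define D where "D = (\<Sum>k\<in>UNIV. length (r k))"
  have D: "length (r k) \<le> D" for k
    unfolding D_def by (rule member_le_sum) auto
  have "0 \<le> \<theta> k i" if "i \<le> length (r k)" "i + (D - length (r k)) = s" for s k i
    using that
  proof (induction s arbitrary: k i rule: less_induct)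
    case (less s)
    show ?case
    proof (cases i)
      case 0
      then show ?thesis using T x by (simp add: tail_dropping_def)
    next
      case (Suc i0)
      have i0: "i0 < length (r k)" using less.prems Suc by simp
      have 1: "0 \<le> \<theta> k i0"
        using less.IH[of "i0 + (D - length (r k))" i0 k] less.prems Suc by simp
      have "0 \<le> link_load r \<theta> (r k ! i0)"
        unfolding link_load_def
      proof (rule sum_nonneg, clarify)
        fix j i' assume j: "i' < length (r j)" "r j ! i' = r k ! i0"
        have "length (r j) - i' = length (r k) - i0"
          using upstream_tree_same_depth[OF U j(1) i0 j(2)] .
        then have "i' + (D - length (r j)) < s"
          using D[of j] D[of k] j(1) i0 less.prems Suc by linarith
        then show "0 \<le> \<theta> j i'"
          using less.IH j(1) by simp
      qed
      then show ?thesis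
        using T i0 1 Suc C pass_fraction_pos[OF C] by (simp add: tail_dropping_def less_imp_le)
    qed
  qed
  then show ?thesis using le by blast
qed

lemma link_load_ge:
  fixes r :: "'k::finite \<Rightarrow> 'l list"
  assumes nonneg: "\<And>k i. i \<le> length (r k) \<Longrightarrow> 0 \<le> \<theta> k i"
    and i: "i < length (r k)"
  shows "\<theta> k i \<le> link_load r \<theta> (r k ! i)"
proof -
  have "finite (SIGMA k:UNIV. {..<length (r k)})" by simp
  then have fin: "finite {(k', i'). i' < length (r k') \<and> r k' ! i' = r k ! i}"
    by (rule rev_finite_subset) auto
  have "(case (k, i) of (k, i) \<Rightarrow> \<theta> k i) \<le> link_load r \<theta> (r k ! i)"
    unfolding link_load_def using i nonneg by (intro member_le_sum fin) auto
  then show ?thesis by simp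
qed

lemma link_load_nonneg:
  assumes "\<And>k i. i \<le> length (r k) \<Longrightarrow> 0 \<le> \<theta> k i"
  shows "0 \<le> link_load r \<theta> l"
  unfolding link_load_def using assms by (intro sum_nonneg) (auto simp: less_imp_le)

lemma tail_dropping_le_input:
  fixes r :: "'k::finite \<Rightarrow> 'l list"
  assumes T: "tail_dropping C r x \<theta>"
    and nonneg: "\<And>k i. i \<le> length (r k) \<Longrightarrow> 0 \<le> \<theta> k i"
    and le: "i \<le> length (r k)"
  shows "\<theta> k i \<le> x k"
  using le
proof (induction i)
  case 0
  then show ?case using T by (simp add: tail_dropping_def)
next
  case (Suc i)
  have "\<theta> k (Suc i) \<le> \<theta> k i"
    using T Suc.prems nonneg[of i k] pass_fraction_le_1
    by (auto simp: tail_dropping_def intro!: mult_left_le)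
  then show ?case using Suc by simp
qed

lemma tail_dropping_pos:
  fixes r :: "'k::finite \<Rightarrow> 'l list"
  assumes T: "tail_dropping C r x \<theta>" and C: "\<And>l. C l > 0"
    and nonneg: "\<And>k i. i \<le> length (r k) \<Longrightarrow> 0 \<le> \<theta> k i"
    and x: "0 < x k" and le: "i \<le> length (r k)"
  shows "0 < \<theta> k i"
  using le
proof (induction i)
  case 0
  then show ?case using T x by (simp add: tail_dropping_def)
next
  case (Suc i)
  then show ?case
    using T pass_fraction_pos[OF C link_load_nonneg[of r \<theta>, OF nonneg]]
    by (simp add: tail_dropping_def)
qed

text \<open>The inequality behind stability. Call a link saturated if its load exceeds its capacity, and group
the classes by the last saturated link of their routes. A class without saturated link receives
its input, which on \<open>S\<close> is at least \<open>y\<close>. In an upstream tree all classes through a link \<open>l\<close> share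
their further route, so if \<open>l\<close> is the last saturated link of one of them, then it is so for all of
them. Link \<open>l\<close> emits exactly \<open>C l\<close>, and nothing of this is lost afterwards; the classes outside \<open>S\<close>
take at most \<open>\<Sum>y\<close> of it, as throughput is bounded by input, and since \<open>y\<close> is feasible at \<open>l\<close> the
remainder covers the \<open>y\<close> of the classes in \<open>S\<close>.\<close>

lemma sum_throughput_ge:
  fixes r :: "'k::finite \<Rightarrow> 'l list"
  assumes U: "upstream_tree r" and C: "\<And>l. C l > 0"
    and x: "\<And>k. 0 \<le> x k"
    and S: "\<And>k. k \<in> S \<Longrightarrow> y k \<le> x k" and nS: "\<And>k. k \<notin> S \<Longrightarrow> x k \<le> y k"
    and y: "\<And>l. (\<Sum>k\<in>{k. l \<in> set (r k)}. y k) \<le> C l"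
  shows "(\<Sum>k\<in>S. y k) \<le> (\<Sum>k\<in>S. throughput C r x k)"
proof -
  obtain \<theta> where T: "tail_dropping C r x \<theta>"
    using tail_dropping_exists[OF U] by blast
  define \<psi> where "\<psi> k = \<theta> k (length (r k))" for k
  have \<psi>: "throughput C r x = \<psi>"
    unfolding \<psi>_def by (rule throughput_eq[OF U T])
  have nonneg: "0 \<le> \<theta> k i" if "i \<le> length (r k)" for k i
    by (rule tail_dropping_nonneg[OF U T C x that])
  define sat where "sat l \<longleftrightarrow> C l < link_load r \<theta> l" for l
  have step: "\<theta> k (Suc i) = \<theta> k i * pass_fraction (C (r k ! i)) (link_load r \<theta> (r k ! i))"
    if "i < length (r k)" for k i
    using T that by (simp add: tail_dropping_def)
  have unsat: "\<psi> k = \<theta> k i"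
    if "i \<le> length (r k)" "\<And>l. l \<in> set (drop i (r k)) \<Longrightarrow> \<not> sat l" for k i
    using that
  proof (induction "length (r k) - i" arbitrary: i)
    case 0
    then show ?case by (simp add: \<psi>_def)
  next
    case (Suc n)
    then have i: "i < length (r k)" by simp
    have *: "drop i (r k) = r k ! i # drop (Suc i) (r k)"
      by (rule Cons_nth_drop_Suc[symmetric, OF i])
    have "\<psi> k = \<theta> k (Suc i)"
      using Suc i * by (intro Suc.hyps(1)) auto
    moreover have "pass_fraction (C (r k ! i)) (link_load r \<theta> (r k ! i)) = 1"
    proof -
      have "\<not> sat (r k ! i)"
        using Suc.prems(2) * by auto
      then show ?thesis
        using link_load_nonneg[of r \<theta> "r k ! i", OF nonneg] C[of "r k ! i"]
        by (auto simp: sat_def pass_fraction_def min_def field_simps)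
    qed
    ultimately show ?case using step[OF i] by simp
  qed
  define last_sat where
    "last_sat k = (if filter sat (r k) = [] then None else Some (last (filter sat (r k))))" for k
  have last_satD: "\<exists>i<length (r k). r k ! i = l \<and> sat l \<and> (\<forall>l'\<in>set (drop (Suc i) (r k)). \<not> sat l')"
    if "last_sat k = Some l" for k l
  proof -
    have "\<exists>z\<in>set (r k). sat z"
      using that by (auto simp: last_sat_def filter_empty_conv split: if_splits)
    then obtain us z vs where *: "r k = us @ z # vs" "sat z" "\<forall>v\<in>set vs. \<not> sat v"
      using split_list_last_prop[of "r k" sat] by metis
    then have "filter sat vs = []" by (simp add: filter_empty_conv)
    then have "l = z" using that * by (simp add: last_sat_def)
    then show ?thesis using * by (intro exI[of _ "length us"]) auto
  qed
  have last_satI: "last_sat k = Some l"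
    if "i < length (r k)" "r k ! i = l" "sat l" "\<forall>l'\<in>set (drop (Suc i) (r k)). \<not> sat l'" for k i l
  proof -
    have "filter sat (drop (Suc i) (r k)) = []" using that(4) by (simp add: filter_empty_conv)
    then show ?thesis
      using id_take_nth_drop[OF that(1)] that(2,3)
      by (subst last_sat_def) (metis (no_types, lifting) filter.simps(2) filter_append last_snoc snoc_eq_iff_butlast)
  qed
  have group: "(\<Sum>k\<in>{k \<in> S. last_sat k = v}. y k) \<le> (\<Sum>k\<in>{k \<in> S. last_sat k = v}. \<psi> k)" for v
  proof (cases v)
    case None
    show ?thesis
    proof (rule sum_mono)
      fix k assume "k \<in> {k \<in> S. last_sat k = v}"
      then have k: "k \<in> S" and "\<forall>l\<in>set (r k). \<not> sat l"
        using None by (auto simp: last_sat_def filter_empty_conv split: if_splits)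
      then have "\<psi> k = \<theta> k 0" by (intro unsat) auto
      then show "y k \<le> \<psi> k" using T S[OF k] by (simp add: tail_dropping_def)
    qed
  next
    case (Some l)
    show ?thesis
    proof (cases "\<exists>k. last_sat k = Some l")
      case False
      then show ?thesis using Some by simp
    next
      case True
      define G where "G = {k. l \<in> set (r k)}"
      from True obtain k0 i0 where i0: "i0 < length (r k0)" "r k0 ! i0 = l" and sat: "sat l"
        and nsat: "\<forall>l'\<in>set (drop (Suc i0) (r k0)). \<not> sat l'"
        using last_satD by metis
      \<comment> \<open>All classes through \<open>l\<close> share the rest of their routes, so none meets a saturated link later.\<close>
      have pass: "\<forall>l'\<in>set (drop (Suc i) (r k)). \<not> sat l'" if "i < length (r k)" "r k ! i = l" for k i
      proof -
        have "drop i (r k) = drop i0 (r k0)"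
          using upstream_tree_same_suffix[OF U that(1) i0(1)] that(2) i0(2) by simp
        then have "drop (Suc i) (r k) = drop (Suc i0) (r k0)"
          by (metis drop_Suc tl_drop)
        then show ?thesis using nsat by simp
      qed
      have G: "last_sat k = Some l \<longleftrightarrow> k \<in> G" for k
        using last_satD[of k l] last_satI[OF _ _ sat] pass unfolding G_def
        by (auto simp: in_set_conv_nth)
      have "\<forall>k\<in>G. \<exists>i<length (r k). r k ! i = l"
        by (auto simp: G_def in_set_conv_nth)
      then obtain p where p: "\<And>k. k \<in> G \<Longrightarrow> p k < length (r k) \<and> r k ! p k = l"
        by metis
      have dist: "distinct (r k)" for k using U by (simp add: upstream_tree_def)
      have load: "link_load r \<theta> l = (\<Sum>k\<in>G. \<theta> k (p k))"
      proof -
        have "i = p k" if "i < length (r k)" "r k ! i = l" for k i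
          using that p[of k] dist[of k] by (auto simp: G_def nth_eq_iff_index_eq)
        then have "{(k, i). i < length (r k) \<and> r k ! i = l} = (\<lambda>k. (k, p k)) ` G"
          using p by (auto simp: G_def)
        then show ?thesis
          unfolding link_load_def by (simp add: sum.reindex inj_on_def)
      qed
      have "\<psi> k = \<theta> k (p k) * (C l / link_load r \<theta> l)" if "k \<in> G" for k
      proof -
        have "\<psi> k = \<theta> k (Suc (p k))"
          using p[OF that] pass[of "p k" k] by (intro unsat) auto
        also have "\<dots> = \<theta> k (p k) * pass_fraction (C l) (link_load r \<theta> l)"
          using step[of "p k" k] p[OF that] by simp
        also have "pass_fraction (C l) (link_load r \<theta> l) = C l / link_load r \<theta> l"
          using sat C[of l] by (simp add: sat_def pass_fraction_def)
        finally show ?thesis .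
      qed
      then have "(\<Sum>k\<in>G. \<psi> k) = (\<Sum>k\<in>G. \<theta> k (p k) * (C l / link_load r \<theta> l))"
        by (intro sum.cong refl)
      also have "\<dots> = link_load r \<theta> l * (C l / link_load r \<theta> l)"
        unfolding load by (rule sum_distrib_right[symmetric])
      also have "\<dots> = C l"
        using sat C[of l] by (simp add: sat_def)
      finally have full: "(\<Sum>k\<in>G. \<psi> k) = C l" .
      have split: "(\<Sum>k\<in>G. f k) = (\<Sum>k\<in>G \<inter> S. f k) + (\<Sum>k\<in>G - S. f k)" for f :: "'k \<Rightarrow> real"
        by (rule sum.Int_Diff) simp
      have \<psi>_le: "\<psi> k \<le> x k" for k
        unfolding \<psi>_def by (rule tail_dropping_le_input[OF T]) (use nonneg in auto)
      have "(\<Sum>k\<in>G - S. \<psi> k) \<le> (\<Sum>k\<in>G - S. y k)"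
        by (intro sum_mono order_trans[OF \<psi>_le nS]) auto
      moreover have "(\<Sum>k\<in>G. y k) \<le> C l"
        using y[of l] by (simp add: G_def)
      ultimately have "(\<Sum>k\<in>G \<inter> S. y k) \<le> (\<Sum>k\<in>G \<inter> S. \<psi> k)"
        using full split[of y] split[of \<psi>] by linarith
      moreover have "{k \<in> S. last_sat k = v} = G \<inter> S"
        using Some G by auto
      ultimately show ?thesis by simp
    qed
  qed
  have part: "(\<Sum>k\<in>S. f k) = (\<Sum>v\<in>range last_sat. \<Sum>k\<in>{k \<in> S. last_sat k = v}. f k)" for f :: "'k \<Rightarrow> real"
    by (rule sum.group[symmetric]) auto
  show ?thesis
    unfolding \<psi> part by (rule sum_mono) (rule group)
qed

lemma flow_throughput_pos:
  fixes r :: "'k::finite \<Rightarrow> 'l list"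
  assumes U: "upstream_tree r" and C: "\<And>l. C l > 0" and a: "\<And>k. 0 < a k" and n: "0 < n k"
  shows "0 < flow_throughput C r a n k"
proof -
  let ?x = "\<lambda>k. a k * real (n k)"
  obtain \<theta> where T: "tail_dropping C r ?x \<theta>"
    using tail_dropping_exists[OF U] by blast
  have x: "0 \<le> ?x k" for k using a[of k] by simp
  have "0 < ?x k" using a n by simp
  then show ?thesis
    unfolding flow_throughput_def throughput_eq[OF U T]
    by (intro tail_dropping_pos[OF T C tail_dropping_nonneg[OF U T C x]]) auto
qed

lemma throughput_bounds:
  fixes r :: "'k::finite \<Rightarrow> 'l list"
  assumes U: "upstream_tree r" and C: "\<And>l. C l > 0" and x: "\<And>k. 0 \<le> x k"
  shows "0 \<le> throughput C r x k" and "throughput C r x k \<le> C (last (r k))"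
proof -
  obtain \<theta> where T: "tail_dropping C r x \<theta>"
    using tail_dropping_exists[OF U] by blast
  note nonneg = tail_dropping_nonneg[OF U T C x]
  show "0 \<le> throughput C r x k"
    unfolding throughput_eq[OF U T] by (rule nonneg) simp
  define i where "i = length (r k) - 1"
  have "r k \<noteq> []" using U by (simp add: upstream_tree_def)
  then have i: "i < length (r k)" "length (r k) = Suc i" "r k ! i = last (r k)"
    by (auto simp: i_def last_conv_nth)
  let ?R = "link_load r \<theta> (last (r k))"
  have le: "\<theta> k i \<le> ?R"
    using link_load_ge[of r \<theta> i k] nonneg i by simp
  have "\<theta> k (Suc i) = \<theta> k i * pass_fraction (C (last (r k))) ?R"
    using T i by (simp add: tail_dropping_def)
  also have "\<dots> \<le> C (last (r k))"
  proof (cases "?R = 0")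
    case True
    then show ?thesis using le C[of "last (r k)"] by (simp add: pass_fraction_def)
  next
    case False
    then have R: "?R > 0" using link_load_nonneg[of r \<theta> "last (r k)", OF nonneg] by simp
    have "\<theta> k i * pass_fraction (C (last (r k))) ?R \<le> ?R * (C (last (r k)) / ?R)"
      using le R nonneg[of i k] i C[of "last (r k)"] by (intro mult_mono) (auto simp: pass_fraction_def)
    then show ?thesis using R by simp
  qed
  finally show "throughput C r x k \<le> C (last (r k))"
    unfolding throughput_eq[OF U T] using i by simp
qed

section \<open>The generator and the jump distribution\<close>

definition generator :: "('s \<Rightarrow> 's \<Rightarrow> real) \<Rightarrow> ('s \<Rightarrow> real) \<Rightarrow> 's \<Rightarrow> real" where
  "generator q V y = (\<Sum>z | q y z \<noteq> 0. q y z * (V z - V y))"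

lemma generator_eq_sum:
  assumes "finite A" "\<And>z. z \<notin> A \<Longrightarrow> q y z = 0"
  shows "generator q V y = (\<Sum>z\<in>A. q y z * (V z - V y))"
  unfolding generator_def using assms by (intro sum.mono_neutral_left) auto

lemma generator_sum:
  "generator q (\<lambda>z. \<Sum>i\<in>I. f i z) y = (\<Sum>i\<in>I. generator q (f i) y)"
  unfolding generator_def sum_subtractf[symmetric] sum_distrib_left by (rule sum.swap)

lemma generator_affine:
  "generator q (\<lambda>z. a * f z + b * g z + c) y = a * generator q f y + b * generator q g y"
  unfolding generator_def sum_distrib_left sum.distrib[symmetric]
  by (intro sum.cong refl) (simp add: algebra_simps)

lemma exit_rate_eq_sum:
  assumes "finite {z. q y z \<noteq> 0}"
  shows "exit_rate q y = (\<Sum>z\<in>{z. q y z \<noteq> 0} - {y}. q y z)"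
proof -
  have "exit_rate q y = infsum (q y) ({z. q y z \<noteq> 0} - {y})"
    unfolding exit_rate_def by (rule infsum_cong_neutral) auto
  then show ?thesis using assms by simp
qed

lemma generator_eq_exit_rate:
  assumes fin: "finite {z. q y z \<noteq> 0}"
  shows "generator q V y = (\<Sum>z\<in>{z. q y z \<noteq> 0} - {y}. q y z * V z) - exit_rate q y * V y"
proof -
  have "generator q V y = (\<Sum>z\<in>{z. q y z \<noteq> 0} - {y}. q y z * (V z - V y))"
    unfolding generator_def using fin by (intro sum.mono_neutral_right) auto
  then show ?thesis
    by (simp add: exit_rate_eq_sum[of q y, OF fin] sum_subtractf right_diff_distrib sum_distrib_right)
qed

text \<open>One step of the jump chain, expressed by the generator: this is how drift conditions, which are
statements about rates, enter the discrete recursion.\<close>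

lemma nn_integral_jump_pmf:
  fixes q :: "'s::countable \<Rightarrow> 's \<Rightarrow> real"
  assumes nonneg: "\<And>z. 0 \<le> q y z" and fin: "finite {z. q y z \<noteq> 0}"
    and exit: "0 < exit_rate q y" and W: "\<And>z. 0 \<le> W z"
  shows "(\<integral>\<^sup>+z. ennreal (W z) \<partial>jump_pmf q y) = ennreal (W y + generator q W y / exit_rate q y)"
proof -
  let ?A = "{z. q y z \<noteq> 0} - {y}"
  have summable: "q y summable_on - {y}"
    by (rule summable_on_cong_neutral[THEN iffD1, OF _ _ _ summable_on_finite[of ?A]])
       (use fin in auto)
  have pmf: "pmf (jump_pmf q y) z = (if z = y then 0 else q y z / exit_rate q y)" for z
    using exit by (intro pmf_jump_pmf nonneg summable) auto
  have "(\<integral>\<^sup>+z. ennreal (W z) \<partial>jump_pmf q y) = (\<Sum>z\<in>?A. ennreal (W z) * ennreal (pmf (jump_pmf q y) z))"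
    using fin pmf by (intro nn_integral_measure_pmf_support) (auto simp: set_pmf_iff split: if_splits)
  also have "\<dots> = (\<Sum>z\<in>?A. ennreal (q y z * W z / exit_rate q y))"
    using W by (intro sum.cong refl) (simp add: pmf ennreal_mult'[symmetric] mult.commute)
  also have "\<dots> = ennreal (\<Sum>z\<in>?A. q y z * W z / exit_rate q y)"
    using W nonneg exit by (intro sum_ennreal) auto
  also have "(\<Sum>z\<in>?A. q y z * W z / exit_rate q y) = W y + generator q W y / exit_rate q y"
    using exit by (simp add: generator_eq_exit_rate[of q y, OF fin] sum_divide_distrib diff_divide_distrib)
  finally show ?thesis .
qed

section \<open>First-step analysis of the return time\<close>

abbreviation jump_step :: "('s::countable \<Rightarrow> 's \<Rightarrow> real) \<Rightarrow> (real \<times> ('s \<Rightarrow> 's)) measure" where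
  "jump_step q \<equiv> density lborel (exponential_density 1) \<Otimes>\<^sub>M (\<Pi>\<^sub>M x\<in>UNIV. measure_pmf (jump_pmf q x))"

lemma prob_space_successors:
  "prob_space (\<Pi>\<^sub>M x\<in>(UNIV :: 's::countable set). measure_pmf (jump_pmf q x))"
  by (intro prob_space_PiM prob_space_measure_pmf)

lemma prob_space_clock: "prob_space (density lborel (exponential_density 1))"
  by (rule prob_space_exponential_density) simp

lemma prob_space_jump_step: "prob_space (jump_step q)"
proof -
  interpret P: pair_prob_space "density lborel (exponential_density 1)" "\<Pi>\<^sub>M x\<in>UNIV. measure_pmf (jump_pmf q x)"
    using prob_space_successors prob_space_clock
    by (intro pair_prob_space.intro pair_sigma_finite.intro prob_space_imp_sigma_finite)
  show ?thesis by unfold_locales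
qed

lemma measurable_successor [measurable]:
  "(\<lambda>e. snd e y) \<in> jump_step q \<rightarrow>\<^sub>M count_space UNIV"
proof -
  have "(\<lambda>f. f y) \<in> (\<Pi>\<^sub>M x\<in>UNIV. measure_pmf (jump_pmf q x)) \<rightarrow>\<^sub>M measure_pmf (jump_pmf q y)"
    by (rule measurable_component_singleton) simp
  then have "(\<lambda>f. f y) \<in> (\<Pi>\<^sub>M x\<in>UNIV. measure_pmf (jump_pmf q x)) \<rightarrow>\<^sub>M count_space UNIV"
    by (simp cong: measurable_cong_sets)
  then show ?thesis by measurable
qed

lemma measurable_clock [measurable]: "fst \<in> borel_measurable (jump_step q)"
proof -
  have "fst \<in> jump_step q \<rightarrow>\<^sub>M density lborel (exponential_density 1)" by (rule measurable_fst)
  then show ?thesis by (simp cong: measurable_cong_sets)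
qed

lemma nn_integral_successor:
  "(\<integral>\<^sup>+e. f (snd e y) \<partial>jump_step q) = (\<integral>\<^sup>+z. f z \<partial>jump_pmf q y)"
proof -
  interpret S: prob_space "\<Pi>\<^sub>M x\<in>UNIV. measure_pmf (jump_pmf q x)" by (rule prob_space_successors)
  interpret E: prob_space "density lborel (exponential_density 1)" by (rule prob_space_clock)
  have "(\<integral>\<^sup>+e. f (snd e y) \<partial>jump_step q) =
      (\<integral>\<^sup>+t. \<integral>\<^sup>+g. f (g y) \<partial>(\<Pi>\<^sub>M x\<in>UNIV. measure_pmf (jump_pmf q x)) \<partial>density lborel (exponential_density 1))"
    by (subst S.nn_integral_fst[symmetric]) (auto intro: measurable_compose[OF measurable_successor])
  also have "\<dots> = (\<integral>\<^sup>+g. f (g y) \<partial>(\<Pi>\<^sub>M x\<in>UNIV. measure_pmf (jump_pmf q x)))"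
    using E.emeasure_space_1 by simp
  also have "\<dots> = (\<integral>\<^sup>+z. f z \<partial>distr (\<Pi>\<^sub>M x\<in>UNIV. measure_pmf (jump_pmf q x)) (measure_pmf (jump_pmf q y)) (\<lambda>g. g y))"
    by (subst nn_integral_distr) (auto intro!: measurable_component_singleton)
  also have "\<dots> = (\<integral>\<^sup>+z. f z \<partial>jump_pmf q y)"
    by (subst distr_PiM_component) (auto intro: prob_space_measure_pmf)
  finally show ?thesis .
qed

lemma nn_integral_clock: "(\<integral>\<^sup>+e. ennreal (fst e) \<partial>jump_step q) = 1"
proof -
  interpret S: prob_space "\<Pi>\<^sub>M x\<in>UNIV. measure_pmf (jump_pmf q x)" by (rule prob_space_successors)
  have "(\<integral>\<^sup>+e. ennreal (fst e) \<partial>jump_step q) =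
      (\<integral>\<^sup>+t. \<integral>\<^sup>+g. ennreal t \<partial>(\<Pi>\<^sub>M x\<in>UNIV. measure_pmf (jump_pmf q x)) \<partial>density lborel (exponential_density 1))"
    by (subst S.nn_integral_fst[symmetric]) auto
  also have "\<dots> = (\<integral>\<^sup>+t. ennreal t \<partial>density lborel (exponential_density 1))"
    using S.emeasure_space_1 by simp
  also have "\<dots> = (\<integral>\<^sup>+t. ennreal (exponential_density 1 t) * ennreal t \<partial>lborel)"
    by (subst nn_integral_density) auto
  also have "\<dots> = (\<integral>\<^sup>+t. ennreal (exponential_density 1 t * t ^ 1) \<partial>lborel)"
    by (intro nn_integral_cong) (simp add: ennreal_mult'[symmetric] exponential_density_nonneg)
  also have "\<dots> = 1"
    by (subst nn_integral_erlang_ith_moment) auto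
  finally show ?thesis .
qed

lemma AE_clock_pos: "AE \<omega> in jump_noise q. \<forall>n. 0 < fst (\<omega> !! n)"
proof -
  interpret M: prob_space "jump_step q" by (rule prob_space_jump_step)
  interpret P: pair_prob_space "density lborel (exponential_density 1)" "\<Pi>\<^sub>M x\<in>UNIV. measure_pmf (jump_pmf q x)"
    using prob_space_successors prob_space_clock by (intro pair_prob_space.intro pair_sigma_finite.intro prob_space_imp_sigma_finite)
  have "AE t in lborel. t \<noteq> (0::real)"
    by (rule AE_lborel_singleton)
  then have "AE t in density lborel (exponential_density 1). 0 < (t::real)"
    by (subst AE_density) (auto simp: exponential_density_def elim!: eventually_mono split: if_splits)
  moreover have "{e \<in> space (jump_step q). 0 < fst e} \<in> sets (jump_step q)"
    by measurable
  ultimately have "AE e in jump_step q. 0 < fst e"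
    by (intro P.AE_pair_measure) (auto elim!: eventually_mono simp del: space_density)
  then have "AE \<omega> in jump_noise q. stream_all (\<lambda>e. 0 < fst e) \<omega>"
    unfolding jump_noise_def by (intro M.AE_stream_all) auto
  then show ?thesis by (simp add: stream.pred_set sset_range)
qed

text \<open>The cost accumulated until the chain hits \<open>x\<close>, stopped after at most \<open>N\<close> jumps. Each jump is charged
its holding time plus one. The holding times dominate the return time if \<open>x\<close> is hit; the extra unit
makes the total infinite if \<open>x\<close> is never hit, even when the jump times accumulate. A finite mean
of this single quantity thus gives both recurrence and integrability. Recursion over the first
element of the stream matches the first-step decomposition of the mean.\<close>

primrec return_cost ::
    "('s::countable \<Rightarrow> 's \<Rightarrow> real) \<Rightarrow> 's \<Rightarrow> nat \<Rightarrow> 's \<Rightarrow> (real \<times> ('s \<Rightarrow> 's)) stream \<Rightarrow> ennreal" where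
  "return_cost q x 0 y \<omega> = 0"
| "return_cost q x (Suc N) y \<omega> = ennreal (fst (shd \<omega>)) / ennreal (exit_rate q y) + 1 +
     (if snd (shd \<omega>) y = x then 0 else return_cost q x N (snd (shd \<omega>) y) (stl \<omega>))"

lemma measurable_return_cost [measurable]:
  "return_cost q x N y \<in> borel_measurable (stream_space (jump_step q))"
proof (induction N arbitrary: y)
  case 0
  then show ?case by simp
next
  case (Suc N)
  have succ: "(\<lambda>\<omega>. snd (shd \<omega>) y) \<in> stream_space (jump_step q) \<rightarrow>\<^sub>M count_space UNIV"
    by (rule measurable_compose[OF measurable_shd measurable_successor])
  have clock: "(\<lambda>\<omega>. fst (shd \<omega>)) \<in> borel_measurable (stream_space (jump_step q))"
    by (rule measurable_compose[OF measurable_shd measurable_clock])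
  have [measurable]: "(\<lambda>\<omega>. return_cost q x N z (stl \<omega>)) \<in> borel_measurable (stream_space (jump_step q))" for z
    by (rule measurable_compose[OF measurable_stl Suc])
  have "(\<lambda>\<omega>. if snd (shd \<omega>) y = x then 0 else return_cost q x N (snd (shd \<omega>) y) (stl \<omega>))
      \<in> borel_measurable (stream_space (jump_step q))"
    by (rule measurable_compose_countable[where f = "\<lambda>z \<omega>. if z = x then 0 else return_cost q x N z (stl \<omega>)", OF _ succ]) auto
  then show ?case
    using clock by simp
qed

lemma nn_integral_return_cost_Suc:
  "(\<integral>\<^sup>+\<omega>. return_cost q x (Suc N) y \<omega> \<partial>jump_noise q) =
     1 / ennreal (exit_rate q y) + 1 +
     (\<integral>\<^sup>+z. (if z = x then 0 else \<integral>\<^sup>+\<omega>. return_cost q x N z \<omega> \<partial>jump_noise q) \<partial>jump_pmf q y)"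
proof -
  interpret M: prob_space "jump_step q" by (rule prob_space_jump_step)
  interpret N: prob_space "stream_space (jump_step q)" by (rule M.prob_space_stream_space)
  let ?I = "\<lambda>z. if z = x then 0 else \<integral>\<^sup>+\<omega>. return_cost q x N z \<omega> \<partial>jump_noise q"
  have "(\<integral>\<^sup>+\<omega>. return_cost q x (Suc N) y \<omega> \<partial>jump_noise q) =
      (\<integral>\<^sup>+e. \<integral>\<^sup>+\<omega>. return_cost q x (Suc N) y (e ## \<omega>) \<partial>stream_space (jump_step q) \<partial>jump_step q)"
    unfolding jump_noise_def by (rule M.nn_integral_stream_space) (rule measurable_return_cost)
  also have "\<dots> = (\<integral>\<^sup>+e. ennreal (fst e) / ennreal (exit_rate q y) + (1 + ?I (snd e y)) \<partial>jump_step q)"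
    by (intro nn_integral_cong)
       (simp add: nn_integral_add N.emeasure_space_1 jump_noise_def add.assoc)
  also have "\<dots> = (\<integral>\<^sup>+e. ennreal (fst e) \<partial>jump_step q) / ennreal (exit_rate q y) +
      (1 + (\<integral>\<^sup>+e. ?I (snd e y) \<partial>jump_step q))"
    by (simp add: nn_integral_add M.emeasure_space_1 nn_integral_divide
          measurable_compose[OF measurable_successor] )
  finally show ?thesis
    unfolding nn_integral_clock nn_integral_successor[where f = ?I] by (simp add: add.assoc)
qed

lemma incseq_return_cost: "incseq (\<lambda>N. return_cost q x N y \<omega>)"
proof (rule incseq_SucI)
  fix N show "return_cost q x N y \<omega> \<le> return_cost q x (Suc N) y \<omega>"
    by (induction N arbitrary: y \<omega>) (auto intro: add_left_mono)
qed

lemma jump_chain_Suc_shift: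
  "jump_chain y \<omega> (Suc n) = jump_chain (snd (shd \<omega>) y) (stl \<omega>) n"
  by (induction n) auto

lemma jump_time_Suc_shift:
  "jump_time q y \<omega> (Suc n) = ennreal (fst (shd \<omega>)) / ennreal (exit_rate q y) +
     jump_time q (snd (shd \<omega>) y) (stl \<omega>) n"
proof -
  have "holding_time q y \<omega> (Suc i) = holding_time q (snd (shd \<omega>) y) (stl \<omega>) i" for i
    by (simp only: holding_time_def jump_chain_Suc_shift snth.simps)
  then show ?thesis
    by (simp only: jump_time_def sum.lessThan_Suc_shift) (simp add: holding_time_def)
qed

lemma return_cost_cases:
  "(\<exists>T\<ge>1. jump_chain y \<omega> T = x \<and> jump_time q y \<omega> T \<le> return_cost q x N y \<omega>) \<or>
   of_nat N \<le> return_cost q x N y \<omega>"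
proof (induction N arbitrary: y \<omega>)
  case 0
  then show ?case by simp
next
  case (Suc N)
  let ?y = "snd (shd \<omega>) y" and ?h = "ennreal (fst (shd \<omega>)) / ennreal (exit_rate q y)"
  show ?case
  proof (cases "?y = x")
    case True
    then have "jump_chain y \<omega> 1 = x \<and> jump_time q y \<omega> 1 \<le> return_cost q x (Suc N) y \<omega>"
      by (simp add: jump_time_def holding_time_def)
    then show ?thesis by blast
  next
    case False
    consider T where "T \<ge> 1" "jump_chain ?y (stl \<omega>) T = x"
        "jump_time q ?y (stl \<omega>) T \<le> return_cost q x N ?y (stl \<omega>)"
      | "of_nat N \<le> return_cost q x N ?y (stl \<omega>)"
      using Suc[of ?y "stl \<omega>"] by blast
    then show ?thesis
    proof cases
      case 1
      have "?h + jump_time q ?y (stl \<omega>) T \<le> ?h + (1 + return_cost q x N ?y (stl \<omega>))"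
        using 1(3) by (intro add_left_mono) (simp add: add_increasing)
      then have "jump_time q y \<omega> (Suc T) \<le> return_cost q x (Suc N) y \<omega>"
        unfolding jump_time_Suc_shift using False by (simp add: add.assoc)
      moreover have "jump_chain y \<omega> (Suc T) = x"
        unfolding jump_chain_Suc_shift by (rule 1(2))
      ultimately show ?thesis by (intro disjI1 exI[of _ "Suc T"]) auto
    next
      case 2
      then have "1 + of_nat N \<le> ?h + (1 + return_cost q x N ?y (stl \<omega>))"
        by (intro add_increasing add_left_mono) auto
      then show ?thesis using False by (simp add: add.assoc)
    qed
  qed
qed

text \<open>Positive clocks make the interval between consecutive jump times nonempty, so the process really
is at \<open>x\<close> at the time of the jump into \<open>x\<close>.\<close>

lemma return_time_le_jump_time:
  assumes clock: "\<And>n. 0 < fst (\<omega> !! n)" and T: "1 \<le> T" "jump_chain x \<omega> T = x"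
  shows "return_time q x \<omega> \<le> jump_time q x \<omega> T"
proof (cases "jump_time q x \<omega> T = \<infinity>")
  case True
  then show ?thesis by simp
next
  case False
  define t where "t = enn2real (jump_time q x \<omega> T)"
  have t: "ennreal t = jump_time q x \<omega> T"
    using False by (simp add: t_def less_top)
  have mono: "jump_time q x \<omega> m \<le> jump_time q x \<omega> n" if "m \<le> n" for m n
    unfolding jump_time_def using that by (intro sum_mono2) auto
  have hold: "0 < holding_time q x \<omega> T"
    using clock[of T] unfolding holding_time_def
    by (simp add: ennreal_zero_less_divide)
  have "jump_time q x \<omega> (Suc T) = jump_time q x \<omega> T + holding_time q x \<omega> T"
    by (simp add: jump_time_def)
  also have "\<dots> > ennreal t"
    using hold False unfolding t by (metis add.right_neutral ennreal_add_left_cancel_less infinity_ennreal_def)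
  finally have less: "ennreal t < jump_time q x \<omega> (Suc T)" .
  have "(THE n. jump_time q x \<omega> n \<le> ennreal t \<and> ennreal t < jump_time q x \<omega> (Suc n)) = T"
  proof (rule the_equality)
    show "jump_time q x \<omega> T \<le> ennreal t \<and> ennreal t < jump_time q x \<omega> (Suc T)"
      using less t by simp
  next
    fix n assume n: "jump_time q x \<omega> n \<le> ennreal t \<and> ennreal t < jump_time q x \<omega> (Suc n)"
    have "\<not> Suc n \<le> T" using mono[of "Suc n" T] n t by (auto simp: not_le[symmetric])
    moreover have "\<not> Suc T \<le> n" using mono[of "Suc T" n] n less by (auto simp: not_le[symmetric] dest: order_trans)
    ultimately show "n = T" by simp
  qed
  then have "jump_process q x t \<omega> = Some x"
    using less t T unfolding jump_process_def by auto
  moreover have "0 \<le> t" "jump_time q x \<omega> 1 \<le> ennreal t"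
    using mono[OF T(1)] t by (auto simp: t_def)
  ultimately have "return_time q x \<omega> \<le> ennreal t"
    unfolding return_time_def by (intro INF_lower) auto
  then show ?thesis by (simp add: t)
qed

text \<open>As exit rates are at most \<open>\<Lambda>\<close>, a jump costs on average \<open>1 / exit_rate q y + 1\<close>, which is at most
\<open>(\<Lambda> + 1) / exit_rate q y\<close>. The drift condition says that \<open>(\<Lambda> + 1) * W\<close> pays for exactly this: by
induction on the number of jumps it bounds the mean cost of hitting \<open>x\<close> from any other state. The
return from \<open>x\<close> itself costs one more jump, after which the mean of \<open>W\<close> is still finite because only
finitely many states can be reached in one jump.\<close>

lemma finite_mean_return_time:
  fixes q :: "'s::countable \<Rightarrow> 's \<Rightarrow> real"
  assumes nonneg: "\<And>y z. 0 \<le> q y z" and fin: "\<And>y. finite {z. q y z \<noteq> 0}"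
    and bounded: "\<And>y. exit_rate q y \<le> \<Lambda>"
    and W: "\<And>y. 0 \<le> W y" and drift: "\<And>y. y \<noteq> x \<Longrightarrow> generator q W y \<le> -1"
    and x: "exit_rate q x \<noteq> 0"
  shows "(\<integral>\<^sup>+\<omega>. return_time q x \<omega> \<partial>jump_noise q) < \<infinity>"
proof -
  let ?E = "\<lambda>N y. \<integral>\<^sup>+\<omega>. return_cost q x N y \<omega> \<partial>jump_noise q"
  let ?W = "\<lambda>y. (\<Lambda> + 1) * W y"
  have exit_nonneg: "0 \<le> exit_rate q y" for y
    using nonneg by (simp add: exit_rate_eq_sum[OF fin] sum_nonneg)
  have \<Lambda>: "0 \<le> \<Lambda>" using exit_nonneg[of x] bounded[of x] by simp
  have exit: "0 < exit_rate q y" for y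
  proof (cases "y = x")
    case False
    have "exit_rate q y \<noteq> 0"
    proof
      assume *: "exit_rate q y = 0"
      then have "q y z = 0" if "z \<noteq> y" for z
        using that nonneg fin[of y]
        by (subst (asm) exit_rate_eq_sum[OF fin], subst (asm) sum_nonneg_eq_0_iff) auto
      then have "q y z * (W z - W y) = 0" for z by (cases "z = y") auto
      then have "generator q W y = 0" unfolding generator_def by (intro sum.neutral) blast
      then show False using drift[OF False] by simp
    qed
    then show ?thesis using exit_nonneg[of y] by simp
  qed (use x exit_nonneg[of x] in simp)
  have step: "?E (Suc N) y \<le> ennreal (1 / exit_rate q y + 1 + (?W y + generator q ?W y / exit_rate q y))"
    if IH: "\<And>z. z \<noteq> x \<Longrightarrow> ?E N z \<le> ennreal (?W z)" for N y
  proof -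
    have "(\<integral>\<^sup>+z. (if z = x then 0 else ?E N z) \<partial>jump_pmf q y) \<le> (\<integral>\<^sup>+z. ennreal (?W z) \<partial>jump_pmf q y)"
      using IH by (intro nn_integral_mono) auto
    also have "\<dots> = ennreal (?W y + generator q ?W y / exit_rate q y)"
      using W \<Lambda> by (intro nn_integral_jump_pmf nonneg fin exit) auto
    finally have le: "(\<integral>\<^sup>+z. (if z = x then 0 else ?E N z) \<partial>jump_pmf q y) \<le>
        ennreal (?W y + generator q ?W y / exit_rate q y)" .
    have "0 \<le> ?W y + generator q ?W y / exit_rate q y"
    proof -
      have "generator q ?W y \<ge> - exit_rate q y * ?W y"
        using W \<Lambda> nonneg unfolding generator_eq_exit_rate[OF fin]
        by (auto intro!: sum_nonneg mult_nonneg_nonneg)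
      then show ?thesis using exit[of y] by (simp add: field_simps)
    qed
    then have "ennreal (1 / exit_rate q y + 1 + (?W y + generator q ?W y / exit_rate q y)) =
        1 / ennreal (exit_rate q y) + 1 + ennreal (?W y + generator q ?W y / exit_rate q y)"
      using exit[of y] by (simp add: ennreal_plus divide_ennreal[symmetric] del: ennreal_plus[symmetric])
    then show ?thesis
      unfolding nn_integral_return_cost_Suc using le by (simp add: add_left_mono)
  qed
  have bound: "?E N y \<le> ennreal (?W y)" if "y \<noteq> x" for N y
    using that
  proof (induction N arbitrary: y)
    case 0
    then show ?case by simp
  next
    case (Suc N)
    have "generator q ?W y = (\<Lambda> + 1) * generator q W y"
      using generator_affine[of q "\<Lambda> + 1" W 0 W 0 y] by simp
    also have "\<dots> \<le> - (\<Lambda> + 1)"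
      using mult_left_mono[OF drift[OF Suc.prems], of "\<Lambda> + 1"] \<Lambda> by simp
    also have "\<dots> \<le> - (1 + exit_rate q y)" using bounded[of y] by simp
    finally have "generator q ?W y / exit_rate q y \<le> - (1 + exit_rate q y) / exit_rate q y"
      using exit[of y] by (intro divide_right_mono) auto
    also have "\<dots> = - (1 / exit_rate q y) - 1"
      using exit[of y] by (simp add: field_simps)
    finally have "1 / exit_rate q y + 1 + (?W y + generator q ?W y / exit_rate q y) \<le> ?W y"
      by simp
    then show ?case
      using step[OF Suc.IH, of y] ennreal_leI order_trans by blast
  qed
  let ?B = "ennreal (1 / exit_rate q x + 1 + (?W x + generator q ?W x / exit_rate q x))"
  have boundx: "?E N x \<le> ?B" for N
  proof (cases N)
    case (Suc M)
    then show ?thesis using step[OF bound, of M x] by simp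
  qed simp
  have "AE \<omega> in jump_noise q. return_time q x \<omega> \<le> (SUP N. return_cost q x N x \<omega>)"
    using AE_clock_pos
  proof eventually_elim
    case (elim \<omega>)
    let ?s = "SUP N. return_cost q x N x \<omega>"
    show ?case
    proof (cases "?s = \<infinity>")
      case False
      then obtain N where N: "?s < of_nat N"
        by (metis ennreal_Ex_less_of_nat infinity_ennreal_def less_top)
      have le: "return_cost q x N x \<omega> \<le> ?s" by (rule SUP_upper) simp
      then have "\<not> of_nat N \<le> return_cost q x N x \<omega>"
        using N by (meson leD order_trans)
      then obtain T where T: "1 \<le> T" "jump_chain x \<omega> T = x" "jump_time q x \<omega> T \<le> return_cost q x N x \<omega>"
        using return_cost_cases[of x \<omega> x q N] by auto
      then show ?thesis
        using return_time_le_jump_time[of \<omega> T x q] elim le by (meson order_trans)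
    next
      case True
      show ?thesis unfolding True by simp
    qed
  qed
  then have "(\<integral>\<^sup>+\<omega>. return_time q x \<omega> \<partial>jump_noise q) \<le> (\<integral>\<^sup>+\<omega>. (SUP N. return_cost q x N x \<omega>) \<partial>jump_noise q)"
    by (rule nn_integral_mono_AE)
  also have "\<dots> = (SUP N. ?E N x)"
    unfolding jump_noise_def
    using incseq_return_cost[of q x x] measurable_return_cost
    by (intro nn_integral_monotone_convergence_SUP) (auto simp: incseq_def le_fun_def)
  also have "\<dots> \<le> ?B" using boundx by (intro SUP_least) auto
  finally show ?thesis
    by (metis ennreal_less_top infinity_ennreal_def le_less_trans)
qed

section \<open>The Foster criterion\<close>

text \<open>The drift condition leaves a finite set uncontrolled. To correct this, every state \<open>y\<close> needs a
bounded function that does not decrease on average anywhere except at \<open>x\<close>, and strictly increases at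
\<open>y\<close>. It is built along a path from \<open>y\<close> to \<open>x\<close>, backwards from \<open>x\<close>: if \<open>y\<close> has a transition to \<open>z\<close>, and
\<open>z\<close> has been dealt with, add a small multiple of the indicator of \<open>z\<close>.\<close>

lemma bounded_push_towards:
  fixes q :: "'s \<Rightarrow> 's \<Rightarrow> real"
  assumes nonneg: "\<And>y z. 0 \<le> q y z" and fin: "\<And>y. finite {z. q y z \<noteq> 0}"
    and reach: "(y, x) \<in> {(y, z). 0 < q y z}\<^sup>*"
  shows "\<exists>u B. (\<forall>z. 0 \<le> u z \<and> u z \<le> B) \<and> (\<forall>z. z \<noteq> x \<longrightarrow> 0 \<le> generator q u z) \<and>
    (y \<noteq> x \<longrightarrow> 0 < generator q u y)"
  using reach
proof (induction rule: converse_rtrancl_induct)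
  case base
  show ?case by (intro exI[of _ "\<lambda>_. 0"] exI[of _ 0]) (auto simp: generator_def)
next
  case (step y z)
  then obtain u B where uB: "\<And>v. 0 \<le> u v" "\<And>v. u v \<le> B"
    and gen: "\<And>v. v \<noteq> x \<Longrightarrow> 0 \<le> generator q u v" and pos: "z \<noteq> x \<Longrightarrow> 0 < generator q u z"
    and q: "0 < q y z"
    by auto
  let ?i = "\<lambda>v. if v = z then 1 else 0 :: real"
  \<comment> \<open>Only at \<open>z\<close> can adding a positive multiple of this indicator lower the generator.\<close>
  have ind: "generator q ?i v = q v z" if "v \<noteq> z" for v
    using that fin[of v] by (simp add: generator_def if_distrib sum.If_cases if_distribR cong: if_cong)
  show ?case
  proof (cases "y = x \<or> 0 < generator q u y")
    case True
    then show ?thesis using uB gen by (intro exI[of _ u] exI[of _ B]) auto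
  next
    case False
    then have y: "y \<noteq> x" "y \<noteq> z" using pos by auto
    \<comment> \<open>Small enough for the strict positivity at \<open>z\<close> to absorb the loss there; at \<open>x\<close> nothing is claimed.\<close>
    define c where "c = (if z = x then 1 else generator q u z / (1 + \<bar>generator q ?i z\<bar>))"
    have c: "0 < c" using pos by (auto simp: c_def)
    let ?u = "\<lambda>v. c * ?i v + 1 * u v + 0"
    have gen_u: "generator q ?u v = c * generator q ?i v + generator q u v" for v
      by (subst generator_affine) simp
    have u_nonneg: "0 \<le> generator q ?u v" if "v \<noteq> x" for v
    proof (cases "v = z")
      case True
      have "c * \<bar>generator q ?i z\<bar> \<le> generator q u z"
        using True that pos by (simp add: c_def field_simps)
      moreover have "- (c * \<bar>generator q ?i z\<bar>) \<le> c * generator q ?i z"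
        using c by (simp add: abs_if)
      ultimately show ?thesis unfolding gen_u True by linarith
    next
      case False
      then show ?thesis unfolding gen_u ind[OF False] using c nonneg gen[OF that] by simp
    qed
    have u_pos: "0 < generator q ?u y"
      unfolding gen_u ind[OF y(2)] using c q gen[OF y(1)] by (simp add: add_pos_nonneg)
    have u_bounds: "0 \<le> ?u v" "?u v \<le> c + B" for v
      using uB[of v] c by (auto intro: add_increasing)
    show ?thesis
      by (rule exI[of _ ?u], rule exI[of _ "c + B"])
        (intro conjI allI impI u_nonneg u_pos u_bounds)
  qed
qed

text \<open>The Foster criterion. For a given target \<open>x\<close> let \<open>U\<close> be the sum over \<open>F\<close> of the functions from the
previous lemma. Subtracting a large multiple of \<open>U\<close> from \<open>V\<close> makes the drift at most \<open>-1\<close> on \<open>F - {x}\<close>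
as well, keeps it so on the complement of \<open>F\<close> and \<open>x\<close>, and a constant restores nonnegativity since \<open>U\<close> is bounded.\<close>

theorem positive_recurrent_if_negative_drift:
  fixes q :: "'s::countable \<Rightarrow> 's \<Rightarrow> real"
  assumes nonneg: "\<And>y z. 0 \<le> q y z" and fin: "\<And>y. finite {z. q y z \<noteq> 0}"
    and bounded: "\<And>y. exit_rate q y \<le> \<Lambda>"
    and irreducible: "\<And>y x. (y, x) \<in> {(y, z). 0 < q y z}\<^sup>*"
    and V: "\<And>y. 0 \<le> V y" and F: "finite F" and drift: "\<And>y. y \<notin> F \<Longrightarrow> generator q V y \<le> -1"
  shows "positive_recurrent q"
  unfolding positive_recurrent_def
proof (intro allI disjCI)
  fix x assume fin_x: "\<not> (\<integral>\<^sup>+\<omega>. return_time q x \<omega> \<partial>jump_noise q) < \<infinity>"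
  show "exit_rate q x = 0"
  proof (rule ccontr)
    assume x: "exit_rate q x \<noteq> 0"
    have "\<exists>u B. (\<forall>z. 0 \<le> u z \<and> u z \<le> B) \<and> (\<forall>z. z \<noteq> x \<longrightarrow> 0 \<le> generator q u z) \<and>
        (y \<noteq> x \<longrightarrow> 0 < generator q u y)" for y
      by (rule bounded_push_towards[OF nonneg fin irreducible])
    then obtain u B where u: "\<And>y z. 0 \<le> u y z" "\<And>y z. u y z \<le> B y"
      and gen: "\<And>y z. z \<noteq> x \<Longrightarrow> 0 \<le> generator q (u y) z"
      and pos: "\<And>y. y \<noteq> x \<Longrightarrow> 0 < generator q (u y) y"
      by metis
    define U where "U z = (\<Sum>y\<in>F. u y z)" for z
    define BU where "BU = (\<Sum>y\<in>F. B y)"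
    have U: "U z \<le> BU" for z
      unfolding U_def BU_def by (intro sum_mono u)
    have genU: "generator q U z = (\<Sum>y\<in>F. generator q (u y) z)" for z
      unfolding U_def by (rule generator_sum)
    have genU_nonneg: "0 \<le> generator q U z" if "z \<noteq> x" for z
      unfolding genU using gen[OF that] by (rule sum_nonneg)
    have genU_pos: "0 < generator q U z" if "z \<in> F" "z \<noteq> x" for z
      unfolding genU using gen pos that F by (intro sum_pos2[of F z]) auto
    define K where "K = (\<Sum>y\<in>F - {x}. \<bar>generator q V y + 1\<bar> / generator q U y)"
    have K: "\<bar>generator q V y + 1\<bar> \<le> K * generator q U y" if "y \<in> F" "y \<noteq> x" for y
    proof -
      have "\<bar>generator q V y + 1\<bar> / generator q U y \<le> K"
        unfolding K_def using that F genU_pos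
        by (intro member_le_sum) (auto intro!: divide_nonneg_pos)
      then show ?thesis using genU_pos[OF that] by (simp add: field_simps)
    qed
    have K0: "0 \<le> K"
      unfolding K_def using genU_nonneg by (intro sum_nonneg) (auto intro!: divide_nonneg_nonneg)
    define W where "W z = 1 * V z + (- K) * U z + K * BU" for z
    have "generator q W y = generator q V y - K * generator q U y" for y
      unfolding W_def by (subst generator_affine) simp
    then have "generator q W y \<le> -1" if "y \<noteq> x" for y
      using that drift[of y] K[of y] mult_nonneg_nonneg[OF K0 genU_nonneg[OF that]]
      by (cases "y \<in> F") auto
    moreover have "0 \<le> W y" for y
      using V[of y] mult_left_mono[OF U[of y] K0] by (simp add: W_def)
    ultimately show False
      using finite_mean_return_time[OF nonneg fin bounded, of W x] x fin_x by simp
  qed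
qed

section \<open>The flow-level process\<close>

lemma departure_iff:
  fixes n m :: "'k \<Rightarrow> nat"
  shows "n = m(k := Suc (m k)) \<longleftrightarrow> 0 < n k \<and> m = n(k := n k - 1)"
proof
  assume n: "n = m(k := Suc (m k))"
  then have "n k = Suc (m k)" by (metis fun_upd_same)
  then show "0 < n k \<and> m = n(k := n k - 1)"
    using n by (metis diff_Suc_1 fun_upd_triv fun_upd_upd zero_less_Suc)
next
  assume "0 < n k \<and> m = n(k := n k - 1)"
  then show "n = m(k := Suc (m k))" by simp
qed

lemma generator_network:
  fixes V :: "('k::finite \<Rightarrow> nat) \<Rightarrow> real"
  shows "generator (network_rates C r a arr \<mu>) V n =
    (\<Sum>k\<in>UNIV. arr k * (V (n(k := Suc (n k))) - V n) +
       (if 0 < n k then \<mu> k * flow_throughput C r a n k * (V (n(k := n k - 1)) - V n) else 0))"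
    (is "_ = (\<Sum>k\<in>UNIV. ?g k)")
  and finite_network_rates: "finite {m. network_rates C r a arr \<mu> n m \<noteq> 0}"
proof -
  define A where "A = range (\<lambda>k. n(k := Suc (n k))) \<union> range (\<lambda>k. n(k := n k - 1))"
  have A: "finite A" by (simp add: A_def)
  have zero: "network_rates C r a arr \<mu> n m = 0" if "m \<notin> A" for m
    using that unfolding network_rates_def departure_iff[of n]
    by (intro sum.neutral) (auto simp: A_def)
  show "finite {m. network_rates C r a arr \<mu> n m \<noteq> 0}"
    by (rule finite_subset[OF _ A]) (use zero in blast)
  have "generator (network_rates C r a arr \<mu>) V n =
      (\<Sum>m\<in>A. network_rates C r a arr \<mu> n m * (V m - V n))"
    by (rule generator_eq_sum) (use A zero in auto)
  also have "\<dots> = (\<Sum>k\<in>UNIV. \<Sum>m\<in>A. ((if m = n(k := Suc (n k)) then arr k else 0) +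
      (if n = m(k := Suc (m k)) then \<mu> k * flow_throughput C r a n k else 0)) * (V m - V n))"
    unfolding network_rates_def sum_distrib_right by (rule sum.swap)
  also have "\<dots> = (\<Sum>k\<in>UNIV. ?g k)"
  proof (rule sum.cong[OF refl])
    fix k
    let ?up = "n(k := Suc (n k))" and ?dn = "n(k := n k - 1)"
    let ?d = "\<mu> k * flow_throughput C r a n k"
    have "(\<Sum>m\<in>A. ((if m = ?up then arr k else 0) + (if n = m(k := Suc (m k)) then ?d else 0)) * (V m - V n)) =
        (\<Sum>m\<in>A. (if m = ?up then arr k * (V ?up - V n) else 0) +
          (if m = ?dn then if 0 < n k then ?d * (V ?dn - V n) else 0 else 0))"
      unfolding departure_iff[of n] by (intro sum.cong refl) (auto simp: algebra_simps)
    also have "\<dots> = ?g k"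
      using A by (simp add: sum.distrib A_def)
    finally show "(\<Sum>m\<in>A. ((if m = ?up then arr k else 0) +
        (if n = m(k := Suc (m k)) then ?d else 0)) * (V m - V n)) = ?g k" .
  qed
  finally show "generator (network_rates C r a arr \<mu>) V n = (\<Sum>k\<in>UNIV. ?g k)" .
qed

text \<open>The excess of \<open>n k\<close> over an integer threshold grows with arrivals from the threshold on, but shrinks
with departures only strictly above it. The case \<open>n k = t\<close> is the price of the kink of the function.\<close>

lemma generator_network_excess:
  fixes n :: "'k::finite \<Rightarrow> nat"
  assumes \<mu>: "0 < \<mu> k"
  shows "generator (network_rates C r a arr \<mu>) (\<lambda>n. real (n k - t) / \<mu> k) n =
    (if t < n k then arr k / \<mu> k - flow_throughput C r a n k
     else if n k = t then arr k / \<mu> k else 0)"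
proof -
  let ?V = "\<lambda>n. real (n k - t) / \<mu> k"
  let ?g = "\<lambda>j. arr j * (?V (n(j := Suc (n j))) - ?V n) +
       (if 0 < n j then \<mu> j * flow_throughput C r a n j * (?V (n(j := n j - 1)) - ?V n) else 0)"
  have "generator (network_rates C r a arr \<mu>) ?V n = (\<Sum>j\<in>{k}. ?g j)"
    unfolding generator_network by (rule sum.mono_neutral_right) auto
  also have "\<dots> = (if t < n k then arr k / \<mu> k - flow_throughput C r a n k
     else if n k = t then arr k / \<mu> k else 0)"
  proof -
    have up: "?V (n(k := Suc (n k))) - ?V n = (if t \<le> n k then 1 / \<mu> k else 0)"
      by (auto simp: Suc_diff_le add_divide_distrib)
    have dn: "?V (n(k := n k - 1)) - ?V n = (if t < n k then - 1 / \<mu> k else 0)"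
    proof (cases "t < n k")
      case True
      then have "real (n k - 1 - t) = real (n k - t) - 1" by (simp add: of_nat_diff)
      then have "?V (n(k := n k - 1)) = ?V n - 1 / \<mu> k"
        by (simp only: fun_upd_same diff_divide_distrib)
      then show ?thesis using True by simp
    qed simp
    have single: "(\<Sum>j\<in>{k}. ?g j) = ?g k" by simp
    show ?thesis
      using \<mu> unfolding single up dn by auto
  qed
  finally show ?thesis .
qed

lemma network_rates_nonneg:
  fixes r :: "'k::finite \<Rightarrow> 'l list"
  assumes U: "upstream_tree r" and C: "\<And>l. C l > 0" and a: "\<And>k. 0 < a k"
    and arr: "\<And>k. 0 < arr k" and \<mu>: "\<And>k. 0 < \<mu> k"
  shows "0 \<le> network_rates C r a arr \<mu> n m"
    and arrival_rate_pos: "0 < network_rates C r a arr \<mu> n (n(k := Suc (n k)))"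
    and departure_rate_pos: "0 < n k \<Longrightarrow> 0 < network_rates C r a arr \<mu> n (n(k := n k - 1))"
proof -
  have \<phi>: "0 \<le> flow_throughput C r a n k" for n k
    unfolding flow_throughput_def using a by (intro throughput_bounds[OF U C]) (simp add: less_imp_le)
  let ?f = "\<lambda>m k. (if m = n(k := Suc (n k)) then arr k else 0) +
     (if n = m(k := Suc (m k)) then \<mu> k * flow_throughput C r a n k else 0)"
  have f: "0 \<le> ?f m k" for m k
    using arr[of k] \<mu>[of k] \<phi>[of n k] by auto
  show "0 \<le> network_rates C r a arr \<mu> n m"
    unfolding network_rates_def by (rule sum_nonneg) (rule f)
  show "0 < network_rates C r a arr \<mu> n (n(k := Suc (n k)))"
    unfolding network_rates_def
  proof (rule sum_pos2[of _ k])
    show "0 < ?f (n(k := Suc (n k))) k"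
      using arr[of k] \<mu>[of k] \<phi>[of n k] by (intro add_pos_nonneg) auto
  qed (rule f finite UNIV_I)+
  show "0 < network_rates C r a arr \<mu> n (n(k := n k - 1))" if n: "0 < n k"
    unfolding network_rates_def
  proof (rule sum_pos2[of _ k])
    have "n = (n(k := n k - 1))(k := Suc ((n(k := n k - 1)) k))"
      using n by (simp add: fun_eq_iff)
    then show "0 < ?f (n(k := n k - 1)) k"
      using arr[of k] \<mu>[of k] flow_throughput_pos[of r C a n k, OF U C a n] by (intro add_nonneg_pos) auto
  qed (rule f finite UNIV_I)+
qed

text \<open>Every state communicates with the empty network: a flow that is present leaves at a positive rate, and
flows of every class arrive.\<close>

lemma network_irreducible:
  fixes r :: "'k::finite \<Rightarrow> 'l list"
  assumes U: "upstream_tree r" and C: "\<And>l. C l > 0" and a: "\<And>k. 0 < a k"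
    and arr: "\<And>k. 0 < arr k" and \<mu>: "\<And>k. 0 < \<mu> k"
  shows "(n, m) \<in> {(n, m). 0 < network_rates C r a arr \<mu> n m}\<^sup>*"
proof -
  let ?R = "{(n, m). 0 < network_rates C r a arr \<mu> n m}"
  have "(n, \<lambda>_. 0) \<in> ?R\<^sup>* \<and> (\<lambda>_. 0, n) \<in> ?R\<^sup>*" for n
  proof (induction "\<Sum>k\<in>UNIV. n k" arbitrary: n rule: less_induct)
    case less
    show ?case
    proof (cases "n = (\<lambda>_. 0)")
      case False
      then obtain k where k: "0 < n k" by (auto simp: fun_eq_iff)
      let ?n = "n(k := n k - 1)"
      have "(\<Sum>k\<in>UNIV. ?n k) < (\<Sum>k\<in>UNIV. n k)"
        using k by (intro sum_strict_mono_ex1) auto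
      then have IH: "(?n, \<lambda>_. 0) \<in> ?R\<^sup>*" "(\<lambda>_. 0, ?n) \<in> ?R\<^sup>*"
        using less by blast+
      have "(n, ?n) \<in> ?R"
        using departure_rate_pos[OF assms, where n = n and k = k] k by simp
      moreover have "(?n, n) \<in> ?R"
        using arrival_rate_pos[OF assms, where n = ?n and k = k] k by simp
      ultimately show ?thesis
        using IH by (meson converse_rtrancl_into_rtrancl rtrancl_into_rtrancl)
    qed simp
  qed
  then show ?thesis by (meson rtrancl_trans)
qed

lemma exit_rate_network_le:
  fixes r :: "'k::finite \<Rightarrow> 'l list"
  assumes U: "upstream_tree r" and C: "\<And>l. C l > 0" and a: "\<And>k. 0 < a k"
    and arr: "\<And>k. 0 < arr k" and \<mu>: "\<And>k. 0 < \<mu> k"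
  shows "exit_rate (network_rates C r a arr \<mu>) n \<le> (\<Sum>k\<in>UNIV. arr k + \<mu> k * C (last (r k)))"
proof -
  \<comment> \<open>The exit rate is the generator of the indicator of the other states.\<close>
  let ?V = "\<lambda>m. if m = n then 0 else 1 :: real"
  have "exit_rate (network_rates C r a arr \<mu>) n = generator (network_rates C r a arr \<mu>) ?V n"
    by (subst generator_eq_exit_rate) (simp_all add: finite_network_rates exit_rate_eq_sum)
  also have "\<dots> \<le> (\<Sum>k\<in>UNIV. arr k + \<mu> k * C (last (r k)))"
    unfolding generator_network
  proof (intro sum_mono add_mono)
    fix k
    show "arr k * (?V (n(k := Suc (n k))) - ?V n) \<le> arr k"
      using arr[of k] by auto
    have "flow_throughput C r a n k \<le> C (last (r k))"
      unfolding flow_throughput_def using a by (intro throughput_bounds[OF U C]) (simp add: less_imp_le)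
    then show "(if 0 < n k then \<mu> k * flow_throughput C r a n k * (?V (n(k := n k - 1)) - ?V n) else 0)
        \<le> \<mu> k * C (last (r k))"
      using \<mu>[of k] C[of "last (r k)"] by (auto simp: fun_eq_iff)
  qed
  finally show ?thesis .
qed

section \<open>Stability for small access rates\<close>

theorem theorem5:
  fixes C :: "'l::finite \<Rightarrow> real"
    and r :: "'k::finite \<Rightarrow> 'l list"
    and arr \<mu> :: "'k \<Rightarrow> real"
  assumes "\<And>l. C l > 0"
    and "upstream_tree r"
    and "inj r"
    and "\<And>k. arr k > 0"
    and "\<And>k. \<mu> k > 0"
    and "\<And>l. (\<Sum>k\<in>{k. l \<in> set (r k)}. arr k / \<mu> k) < C l"
  shows "\<exists>a :: 'k \<Rightarrow> real. (\<forall>k. a k > 0) \<and> positive_recurrent (network_rates C r a arr \<mu>)"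
proof -
  note C = assms(1) and U = assms(2) and arr = assms(4) and \<mu> = assms(5)
  define \<rho> where "\<rho> k = arr k / \<mu> k" for k
  have \<rho>: "0 < \<rho> k" for k using arr \<mu> by (simp add: \<rho>_def)
  \<comment> \<open>All traffic intensities can be raised by \<open>2 * \<epsilon>\<close> without exceeding a capacity.\<close>
  define slack where "slack l = C l - (\<Sum>k\<in>{k. l \<in> set (r k)}. \<rho> k)" for l
  define \<epsilon> where "\<epsilon> = Min (range slack) / (2 * real CARD('k))"
  have "0 < Min (range slack)"
    using assms(6) by (subst Min_gr_iff) (auto simp: slack_def \<rho>_def)
  then have \<epsilon>: "0 < \<epsilon>" by (simp add: \<epsilon>_def)
  have cap: "(\<Sum>k\<in>{k. l \<in> set (r k)}. \<rho> k + 2 * \<epsilon>) \<le> C l" for l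
  proof -
    have "(\<Sum>k\<in>{k. l \<in> set (r k)}. 2 * \<epsilon>) \<le> (\<Sum>k\<in>(UNIV :: 'k set). 2 * \<epsilon>)"
      using \<epsilon> by (intro sum_mono2) auto
    also have "\<dots> = Min (range slack)" by (simp add: \<epsilon>_def)
    also have "\<dots> \<le> slack l" by (rule Min_le) auto
    finally show ?thesis by (simp add: sum.distrib slack_def)
  qed
  \<comment> \<open>With \<open>M\<close> thresholds per class the gain \<open>M * \<epsilon>\<close> outweighs the total loss \<open>\<Sum>\<rho>\<close> at the kinks.\<close>
  obtain M :: nat where "((\<Sum>k\<in>UNIV. \<rho> k) + 1) / \<epsilon> \<le> real M"
    using real_arch_simple by blast
  then have M: "(\<Sum>k\<in>UNIV. \<rho> k) + 1 \<le> real M * \<epsilon>"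
    using \<epsilon> by (simp add: field_simps)
  \<comment> \<open>\<open>M\<close> further flows of a class, and one for rounding its threshold up, add at most \<open>\<epsilon>\<close> to
    its input rate.\<close>
  define \<alpha> where "\<alpha> = \<epsilon> / real (Suc M)"
  have \<alpha>: "0 < \<alpha>" "\<alpha> * real (Suc M) = \<epsilon>" using \<epsilon> by (simp_all add: \<alpha>_def del: of_nat_Suc)
  define m where "m k = nat \<lceil>(\<rho> k + \<epsilon>) / \<alpha>\<rceil>" for k
  define y where "y u k = \<alpha> * real (m k + u)" for u k
  have y: "\<rho> k + \<epsilon> \<le> y u k" "y u k \<le> \<rho> k + 2 * \<epsilon>" if "u < M" for u k
  proof -
    let ?z = "(\<rho> k + \<epsilon>) / \<alpha>"
    have "0 \<le> ?z" using \<rho>[of k] \<epsilon> \<alpha> by simp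
    then have *: "real (m k) = of_int \<lceil>?z\<rceil>"
      by (simp add: m_def)
    have z: "\<alpha> * ?z = \<rho> k + \<epsilon>" using \<alpha> by simp
    have "?z \<le> real (m k)" unfolding * by (rule le_of_int_ceiling)
    then have "?z \<le> real (m k + u)" by simp
    then have "\<alpha> * ?z \<le> \<alpha> * real (m k + u)" using \<alpha> by (intro mult_left_mono) auto
    then show "\<rho> k + \<epsilon> \<le> y u k" unfolding y_def z .
    have "real (m k) \<le> ?z + 1" unfolding * by (rule of_int_ceiling_le_add_one)
    then have "real (m k + u) \<le> ?z + real (Suc M)" using that by simp
    then have "\<alpha> * real (m k + u) \<le> \<alpha> * (?z + real (Suc M))" using \<alpha> by (intro mult_left_mono) auto
    also have "\<dots> = \<rho> k + 2 * \<epsilon>" unfolding distrib_left z \<alpha>(2) by simp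
    finally show "y u k \<le> \<rho> k + 2 * \<epsilon>" unfolding y_def .
  qed
  let ?q = "network_rates C r (\<lambda>_. \<alpha>) arr \<mu>"
  let ?\<phi> = "flow_throughput C r (\<lambda>_. \<alpha>)"
  define V where "V n = (\<Sum>u<M. \<Sum>k\<in>UNIV. real (n k - (m k + u)) / \<mu> k)" for n :: "'k \<Rightarrow> nat"
  define F where "F = {n :: 'k \<Rightarrow> nat. \<forall>k. n k < m k + M}"
  have "F = PiE UNIV (\<lambda>k. {..<m k + M})"
    by (auto simp: F_def PiE_UNIV_domain)
  then have F: "finite F" by (simp add: finite_PiE)
  have drift: "generator ?q V n \<le> -1" if n: "n \<notin> F" for n
  proof -
    define S where "S u = {k. m k + u < n k}" for u
    have "generator ?q V n = (\<Sum>u<M. \<Sum>k\<in>UNIV.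
        (if m k + u < n k then \<rho> k - ?\<phi> n k else if n k = m k + u then \<rho> k else 0))"
      unfolding V_def generator_sum \<rho>_def using \<mu> by (simp only: generator_network_excess)
    also have "\<dots> = (\<Sum>u<M. \<Sum>k\<in>S u. \<rho> k - ?\<phi> n k) + (\<Sum>u<M. \<Sum>k\<in>UNIV. if n k = m k + u then \<rho> k else 0)"
    proof -
      have "(\<Sum>k\<in>UNIV. if m k + u < n k then \<rho> k - ?\<phi> n k else if n k = m k + u then \<rho> k else 0) =
          (\<Sum>k\<in>S u. \<rho> k - ?\<phi> n k) + (\<Sum>k\<in>UNIV. if n k = m k + u then \<rho> k else 0)" for u
      proof -
        have "(\<Sum>k\<in>S u. \<rho> k - ?\<phi> n k) = (\<Sum>k\<in>UNIV. if m k + u < n k then \<rho> k - ?\<phi> n k else 0)"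
          unfolding S_def by (simp add: sum.If_cases)
        then show ?thesis
          by (simp only: sum.distrib[symmetric]) (intro sum.cong refl, auto)
      qed
      then show ?thesis by (simp add: sum.distrib)
    qed
    \<comment> \<open>Outside \<open>F\<close> some class exceeds its threshold at every level \<open>u\<close>, while a class is at a
      threshold for at most one \<open>u\<close>.\<close>
    also have "\<dots> \<le> (\<Sum>u<M. - \<epsilon>) + (\<Sum>k\<in>UNIV. \<rho> k)"
    proof (rule add_mono)
      show "(\<Sum>u<M. \<Sum>k\<in>S u. \<rho> k - ?\<phi> n k) \<le> (\<Sum>u<M. - \<epsilon>)"
      proof (rule sum_mono)
        fix u assume "u \<in> {..<M}"
        then have u: "u < M" by simp
        have "(\<Sum>k\<in>S u. y u k) \<le> (\<Sum>k\<in>S u. throughput C r (\<lambda>k. \<alpha> * real (n k)) k)"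
        proof (rule sum_throughput_ge[OF U C])
          fix l
          have "(\<Sum>k\<in>{k. l \<in> set (r k)}. y u k) \<le> (\<Sum>k\<in>{k. l \<in> set (r k)}. \<rho> k + 2 * \<epsilon>)"
            using y(2)[OF u] by (rule sum_mono)
          then show "(\<Sum>k\<in>{k. l \<in> set (r k)}. y u k) \<le> C l" using cap[of l] by simp
        qed (use \<alpha> in \<open>auto simp: S_def y_def simp del: of_nat_add\<close>)
        moreover have "(\<Sum>k\<in>S u. \<rho> k + \<epsilon>) \<le> (\<Sum>k\<in>S u. y u k)"
          using y(1)[OF u] by (rule sum_mono)
        ultimately have "(\<Sum>k\<in>S u. \<rho> k - ?\<phi> n k) \<le> - (real (card (S u)) * \<epsilon>)"
          by (simp add: flow_throughput_def sum.distrib sum_subtractf)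
        also have "\<dots> \<le> - \<epsilon>"
        proof -
          obtain k where "m k + M \<le> n k" using n by (auto simp: F_def not_less)
          then have "k \<in> S u" using u by (simp add: S_def)
          then have "1 \<le> real (card (S u))"
            using card_gt_0_iff[of "S u"] by auto
          then show ?thesis using \<epsilon> by simp
        qed
        finally show "(\<Sum>k\<in>S u. \<rho> k - ?\<phi> n k) \<le> - \<epsilon>" .
      qed
      have "(\<Sum>u<M. if n k = m k + u then \<rho> k else 0) \<le> \<rho> k" for k
      proof -
        have "(\<Sum>u<M. if n k = m k + u then \<rho> k else 0) \<le> (\<Sum>u<M. if u = n k - m k then \<rho> k else 0)"
          using \<rho>[of k] by (intro sum_mono) auto
        also have "\<dots> \<le> \<rho> k" using \<rho>[of k] by simp
        finally show ?thesis .
      qed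
      then show "(\<Sum>u<M. \<Sum>k\<in>UNIV. if n k = m k + u then \<rho> k else 0) \<le> (\<Sum>k\<in>UNIV. \<rho> k)"
        by (subst sum.swap) (rule sum_mono)
    qed
    also have "\<dots> \<le> -1" using M by simp
    finally show ?thesis .
  qed
  have "positive_recurrent ?q"
  proof (rule positive_recurrent_if_negative_drift[OF _ _ _ _ _ F drift])
    show "0 \<le> V n" for n
      using \<mu> by (auto simp: V_def less_imp_le intro!: sum_nonneg)
    show "0 \<le> ?q n n'" for n n'
      using \<alpha> by (intro network_rates_nonneg U C arr \<mu>)
    show "finite {n'. ?q n n' \<noteq> 0}" for n
      by (rule finite_network_rates)
    show "exit_rate ?q n \<le> (\<Sum>k\<in>UNIV. arr k + \<mu> k * C (last (r k)))" for n
      using \<alpha> by (intro exit_rate_network_le U C arr \<mu>)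
    show "(n, n') \<in> {(n, n'). 0 < ?q n n'}\<^sup>*" for n n'
      using \<alpha> by (intro network_irreducible U C arr \<mu>)
  qed
  then show ?thesis using \<alpha> by (intro exI[of _ "\<lambda>_. \<alpha>"]) auto
qed

end
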